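(* If $G$ is a graph that does not contain a universal vertex, then $c_{\min}(G) \ge 4$ if and only if for every vertex $v \in V(G)$ and every partition $\{P,Q\}$ of $N[v]$, at least one of $P$ or $Q$ is a dominating set of $G$.
   Context: Graphs are finite, simple and undirected, with nonempty vertex set. $N[v]$ is the closed neighborhood of $v$, i.e., $v$ together with all its neighbors. A vertex $v$ is universal if $N[v]=V(G)$. A set $S\subseteq V(G)$ is a dominating set of $G$ if every vertex of $V(G)\setminus S$ is adjacent to a vertex of $S$. A partition of a set is a grouping of its elements into nonempty subsets such that every element is in exactly one subset. Two disjoint sets $X,Y\subseteq V(G)$ form a coalition in $G$ if neither $X$ nor $Y$ is a dominating set of $G$ but $X\cup Y$ is a dominating set of $G$. A $c$-partition of $G$ is a partition $\{V_1,\ldots,V_k\}$ of $V(G)$ such that each $V_i$ either is a dominating set consisting of a single vertex, or forms a coalition with some other set $V_j$ ($j\neq i$) of the partition. For partitions $\mathcal{A},\mathcal{B}$ of $V(G)$, $\mathcal{B}$ is a refinement of $\mathcal{A}$ if every set of $\mathcal{B}$ is equal to or a proper subset of some set of $\mathcal{A}$; it is a proper refinement if moreover $\mathcal{A}\ne\mathcal{B}$. A $c$-partition is minimal if it is not a proper refinement of any other $c$-partition of $G$. The minmin coalition number $c_{\min}(G)$ is the minimum number of sets in a minimal $c$-partition of $G$.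
   Formalization: The partition {P,Q} of N[v] is allowed to have P = Q = N[v]; with two distinct nonempty parts required, the claim fails for edgeless graphs on at least two vertices (c_min = 2, condition vacuous), and otherwise the two conditions agree. *)

theory Defs
  imports "Graph_Theory.Digraph" "HOL-Library.Disjoint_Sets"
begin

text \<open>
  The locale \<^locale>\<open>graph\<close> models finite simple undirected graphs as finite, loop-free, symmetric
  digraphs without parallel arcs: an undirected edge between u and v is a pair of opposite
  arcs, and \<open>u \<rightarrow>\<^bsub>G\<^esub> v\<close> is adjacency.
\<close>

definition closed_neighborhood :: "('a, 'b) pre_digraph \<Rightarrow> 'a \<Rightarrow> 'a set" where
  "closed_neighborhood G v = insert v {u. v \<rightarrow>\<^bsub>G\<^esub> u}"

definition universal_vertex :: "('a, 'b) pre_digraph \<Rightarrow> 'a \<Rightarrow> bool" where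
  "universal_vertex G v \<longleftrightarrow> v \<in> verts G \<and> closed_neighborhood G v = verts G"

definition dominating_set :: "('a, 'b) pre_digraph \<Rightarrow> 'a set \<Rightarrow> bool" where
  "dominating_set G S \<longleftrightarrow> S \<subseteq> verts G \<and> (\<forall>v \<in> verts G - S. \<exists>s \<in> S. v \<rightarrow>\<^bsub>G\<^esub> s)"

definition coalition :: "('a, 'b) pre_digraph \<Rightarrow> 'a set \<Rightarrow> 'a set \<Rightarrow> bool" where
  "coalition G X Y \<longleftrightarrow>
     X \<subseteq> verts G \<and> Y \<subseteq> verts G \<and> X \<inter> Y = {} \<and>
     \<not> dominating_set G X \<and> \<not> dominating_set G Y \<and> dominating_set G (X \<union> Y)"

definition c_partition :: "('a, 'b) pre_digraph \<Rightarrow> 'a set set \<Rightarrow> bool" where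
  "c_partition G \<A> \<longleftrightarrow>
     partition_on (verts G) \<A> \<and>
     (\<forall>X \<in> \<A>. (\<exists>v. X = {v} \<and> dominating_set G X) \<or> (\<exists>Y \<in> \<A>. Y \<noteq> X \<and> coalition G X Y))"

definition proper_refinement :: "('a, 'b) pre_digraph \<Rightarrow> 'a set set \<Rightarrow> 'a set set \<Rightarrow> bool" where
  "proper_refinement G \<B> \<A> \<longleftrightarrow> refines (verts G) \<B> \<A> \<and> \<A> \<noteq> \<B>"

definition minimal_c_partition :: "('a, 'b) pre_digraph \<Rightarrow> 'a set set \<Rightarrow> bool" where
  "minimal_c_partition G \<B> \<longleftrightarrow>
     c_partition G \<B> \<and> \<not> (\<exists>\<A>. c_partition G \<A> \<and> proper_refinement G \<B> \<A>)"

text \<open>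
  Every finite simple graph has a c-partition, hence a minimal one, so the infimum below is an
  attained minimum; the value of \<^const>\<open>Inf\<close> at the empty set plays no role.
\<close>

definition c_min :: "('a, 'b) pre_digraph \<Rightarrow> nat" where
  "c_min G = Inf {card \<A> | \<A>. minimal_c_partition G \<A>}"

text \<open>
  In \<open>partition_on (closed_neighborhood G v) {P, Q}\<close> both parts are nonempty. Since
  \<open>{P, Q}\<close> denotes a set, P and Q may coincide, both being then the whole closed neighborhood.
  This one-part case has force only for edgeless graphs: there a closed neighborhood is a
  single vertex and has no partition into two distinct parts, while \<open>c_min G = 2\<close> if the
  graph has at least two vertices. In a graph with an edge, excluding \<open>P = Q\<close> would give an
  equivalent condition.
\<close>

end

theory Submission
  imports Defs
begin

text \<open>
  Call a partition of the vertex set nondominating if none of its parts dominates. In a graph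
  without universal vertices no single vertex dominates, so every \<open>c\<close>-partition is
  nondominating. Conversely, a nondominating partition with as few parts as possible is a
  minimal \<open>c\<close>-partition: if two of its parts had a nondominating union, merging them would save
  a part, so any two parts form a coalition; and a \<open>c\<close>-partition that it properly refines would be
  a nondominating partition with fewer parts. Hence \<open>c_min\<close> is the least number of parts of a
  nondominating partition (\<open>c_min_le_card\<close>, \<open>c_min_attained\<close>), and \<open>c_min \<ge> 4\<close> says that no
  nondominating partition has three or fewer parts.

  Such a partition amounts to a closed neighborhood split into nondominating pieces, because
  a vertex set fails to dominate exactly when it misses some closed neighborhood \<open>N[v]\<close>. If
  \<open>P\<close> and \<open>Q\<close> split \<open>N[v]\<close> and do not dominate, then the remaining vertices miss
  \<open>N[v]\<close> and are a third nondominating part. Conversely, one part of a nondominating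
  partition into at most three parts misses some \<open>N[v]\<close>, so \<open>N[v]\<close> is covered by the at most
  two others, whose traces on \<open>N[v]\<close> do not dominate.
\<close>

section \<open>Sets and partitions\<close>

lemma nonempty_card_le_2E:
  assumes "finite S" "S \<noteq> {}" "card S \<le> 2"
  obtains x y where "S = {x, y}"
proof -
  have "card S = 1 \<or> card S = 2"
    using assms by (metis One_nat_def Suc_1 card_eq_0_iff le_Suc_eq le_zero_eq)
  then show thesis
    by (metis that card_1_singletonE card_2_iff insert_absorb2)
qed

text \<open>
  Choosing in each part of the coarser partition a part of the finer one is injective; were it
  also onto, each coarse part would contain, and hence equal, exactly one fine part.
\<close>

lemma proper_refines_card_less:
  assumes fin: "finite A" and ref: "refines A P Q" and ne: "P \<noteq> Q"
  shows "card Q < card P"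
proof -
  have P: "partition_on A P" and Q: "partition_on A Q"
    using ref by (auto simp: refines_def)
  have finP: "finite P" and finQ: "finite Q"
    using finite_elements[OF fin] P Q by auto
  have "\<exists>p\<in>P. p \<subseteq> q" if "q \<in> Q" for q
  proof -
    have "q = \<Union>{p \<in> P. p \<subseteq> q}" "q \<noteq> {}"
      using refines_obtains_subset[OF ref that] Q that by (auto simp: partition_on_def)
    then show ?thesis by blast
  qed
  then obtain f where f: "\<And>q. q \<in> Q \<Longrightarrow> f q \<in> P \<and> f q \<subseteq> q"
    by metis
  have eq: "q = q'" if "q \<in> Q" "q' \<in> Q" "p \<in> P" "p \<subseteq> q" "p \<subseteq> q'" for p q q'
  proof (rule ccontr)
    assume "q \<noteq> q'"
    then have "q \<inter> q' = {}"
      using Q that by (auto simp: partition_on_def disjoint_def)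
    then have "p = {}"
      using that by blast
    then show False
      using that(3) partition_onD3[OF P] by simp
  qed
  have inj: "inj_on f Q"
    by (rule inj_onI) (metis eq f)
  have le: "card Q \<le> card P"
    using inj f finP by (metis card_inj_on_le image_subsetI)
  have "card Q \<noteq> card P"
  proof
    assume card_eq: "card Q = card P"
    have onto: "f ` Q = P"
      using f finP card_eq inj by (intro card_subset_eq) (auto simp: card_image)
    have "q \<in> P" if q: "q \<in> Q" for q
    proof -
      have "p = f q" if "p \<in> P" "p \<subseteq> q" for p
        using that onto eq f q by (metis imageE)
      then have "{p \<in> P. p \<subseteq> q} = {f q}"
        using f[OF q] by auto
      then have "q = f q"
        using refines_obtains_subset[OF ref q] by (auto simp: partition_on_def)
      then show ?thesis
        using f[OF q] by simp
    qed
    then have "Q = P"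
      using card_eq finP by (metis card_subset_eq subsetI)
    then show False using ne by simp
  qed
  with le show ?thesis by simp
qed

lemma partition_on_merge:
  assumes "partition_on A P" "X \<in> P" "Y \<in> P"
  shows "partition_on A (insert (X \<union> Y) (P - {X, Y}))"
  using assms by (auto simp: partition_on_def disjoint_def)

lemma card_merge_less:
  assumes "finite P" "X \<in> P" "Y \<in> P" "X \<noteq> Y"
  shows "card (insert (X \<union> Y) (P - {X, Y})) < card P"
proof -
  have "card (insert (X \<union> Y) (P - {X, Y})) \<le> Suc (card (P - {X, Y}))"
    by (simp add: card_insert_if assms)
  also have "card (P - {X, Y}) = card P - 2"
    using assms by (subst card_Diff_subset) auto
  also have "Suc (card P - 2) < card P"
    using assms card_mono[of P "{X, Y}"] by auto
  finally show ?thesis .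
qed

section \<open>Domination and closed neighborhoods\<close>

lemma dominating_set_mono:
  "dominating_set G S \<Longrightarrow> S \<subseteq> T \<Longrightarrow> T \<subseteq> verts G \<Longrightarrow> dominating_set G T"
  unfolding dominating_set_def by blast

lemma dominating_set_verts: "dominating_set G (verts G)"
  by (simp add: dominating_set_def)

lemma not_dominating_set_iff:
  assumes "S \<subseteq> verts G"
  shows "\<not> dominating_set G S \<longleftrightarrow> (\<exists>v\<in>verts G. closed_neighborhood G v \<inter> S = {})"
  using assms by (auto simp: dominating_set_def closed_neighborhood_def)

lemma (in wf_digraph) closed_neighborhood_subset_verts:
  "v \<in> verts G \<Longrightarrow> closed_neighborhood G v \<subseteq> verts G"
  by (auto simp: closed_neighborhood_def adj_in_verts)

lemma (in sym_digraph) universal_if_singleton_dominating: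
  assumes "dominating_set G {v}"
  shows "universal_vertex G v"
proof -
  have v: "v \<in> verts G"
    using assms by (simp add: dominating_set_def)
  have "v \<rightarrow>\<^bsub>G\<^esub> u" if "u \<in> verts G" "u \<noteq> v" for u
    using assms that arcs_ends_symmetric[OF sym_arcs] by (auto simp: dominating_set_def)
  then show ?thesis
    using v closed_neighborhood_subset_verts[OF v]
    by (auto simp: universal_vertex_def closed_neighborhood_def)
qed

section \<open>Nondominating partitions\<close>

definition nondominating_partition :: "('a, 'b) pre_digraph \<Rightarrow> 'a set set \<Rightarrow> bool" where
  "nondominating_partition G \<A> \<longleftrightarrow>
     partition_on (verts G) \<A> \<and> (\<forall>X\<in>\<A>. \<not> dominating_set G X)"

locale graph_without_universal_vertex = graph +
  assumes no_universal_vertex: "\<not> (\<exists>v. universal_vertex G v)"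
    and verts_nonempty: "verts G \<noteq> {}"
begin

lemma finite_nondominating_partition: "nondominating_partition G \<A> \<Longrightarrow> finite \<A>"
  unfolding nondominating_partition_def using finite_elements[OF finite_verts] by blast

lemma singleton_not_dominating: "\<not> dominating_set G {v}"
  using no_universal_vertex universal_if_singleton_dominating by blast

lemma c_partition_imp_nondominating:
  "c_partition G \<A> \<Longrightarrow> nondominating_partition G \<A>"
  using singleton_not_dominating
  by (fastforce simp: c_partition_def nondominating_partition_def coalition_def)

lemma singletons_nondominating:
  "nondominating_partition G ((\<lambda>v. {v}) ` verts G)"
  by (simp add: nondominating_partition_def partition_on_singletons singleton_not_dominating)

text \<open>
  A part of a nondominating partition always has a companion, since it cannot be all of
  \<open>verts G\<close>; if the two did not form a coalition, they could be merged.
\<close>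

lemma fewest_parts_imp_c_partition:
  assumes \<A>: "nondominating_partition G \<A>"
    and fewest: "\<And>\<B>. nondominating_partition G \<B> \<Longrightarrow> card \<A> \<le> card \<B>"
  shows "c_partition G \<A>"
proof -
  have part: "partition_on (verts G) \<A>"
    and nondom: "\<And>X. X \<in> \<A> \<Longrightarrow> \<not> dominating_set G X"
    using \<A> by (auto simp: nondominating_partition_def)
  have "\<exists>Y\<in>\<A>. Y \<noteq> X \<and> coalition G X Y" if X: "X \<in> \<A>" for X
  proof -
    have "\<A> \<noteq> {X}"
      using nondom[OF X] partition_onD1[OF part] by (auto simp: dominating_set_verts)
    then obtain Y where Y: "Y \<in> \<A>" "Y \<noteq> X"
      using X by blast
    let ?\<B> = "insert (X \<union> Y) (\<A> - {X, Y})"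
    have "card ?\<B> < card \<A>"
      using X Y finite_nondominating_partition[OF \<A>] by (intro card_merge_less) auto
    then have "\<not> nondominating_partition G ?\<B>"
      using fewest by (meson not_le)
    then have "dominating_set G (X \<union> Y)"
      using partition_on_merge[OF part X Y(1)] nondom
      by (auto simp: nondominating_partition_def)
    moreover have "X \<inter> Y = {}" "X \<subseteq> verts G" "Y \<subseteq> verts G"
      using part X Y by (auto simp: partition_on_def disjoint_def)
    ultimately show ?thesis
      using X Y nondom by (auto simp: coalition_def)
  qed
  then show ?thesis
    using part by (auto simp: c_partition_def)
qed

lemma fewest_parts_imp_minimal_c_partition:
  assumes "nondominating_partition G \<A>"
    and fewest: "\<And>\<B>. nondominating_partition G \<B> \<Longrightarrow> card \<A> \<le> card \<B>"
  shows "minimal_c_partition G \<A>"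
proof -
  have "\<not> proper_refinement G \<A> \<B>" if "c_partition G \<B>" for \<B>
    using proper_refines_card_less[OF finite_verts, of \<A> \<B>]
      fewest[OF c_partition_imp_nondominating[OF that]]
    by (auto simp: proper_refinement_def)
  then show ?thesis
    using fewest_parts_imp_c_partition[OF assms] by (auto simp: minimal_c_partition_def)
qed

lemma ex_fewest_parts:
  obtains \<A> where "nondominating_partition G \<A>"
    and "\<And>\<B>. nondominating_partition G \<B> \<Longrightarrow> card \<A> \<le> card \<B>"
  using ex_has_least_nat[of "nondominating_partition G" _ card, OF singletons_nondominating]
  by metis

lemma c_min_le_card:
  assumes "nondominating_partition G \<B>"
  shows "c_min G \<le> card \<B>"
proof -
  obtain \<A> where \<A>: "nondominating_partition G \<A>"
    and fewest: "\<And>\<B>. nondominating_partition G \<B> \<Longrightarrow> card \<A> \<le> card \<B>"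
    using ex_fewest_parts by blast
  have "minimal_c_partition G \<A>"
    using \<A> fewest by (rule fewest_parts_imp_minimal_c_partition)
  then have "c_min G \<le> card \<A>"
    unfolding c_min_def by (intro cInf_lower) auto
  with fewest[OF assms] show ?thesis by simp
qed

lemma c_min_attained:
  obtains \<A> where "nondominating_partition G \<A>" "card \<A> = c_min G"
proof -
  obtain \<A> where "nondominating_partition G \<A>"
    and "\<And>\<B>. nondominating_partition G \<B> \<Longrightarrow> card \<A> \<le> card \<B>"
    using ex_fewest_parts by blast
  then have "minimal_c_partition G \<A>"
    by (rule fewest_parts_imp_minimal_c_partition)
  then have "{card \<A> | \<A>. minimal_c_partition G \<A>} \<noteq> {}"
    by blast
  then have "c_min G \<in> {card \<A> | \<A>. minimal_c_partition G \<A>}"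
    unfolding c_min_def by (rule Inf_nat_def1)
  then show thesis
    using that by (auto simp: minimal_c_partition_def dest: c_partition_imp_nondominating)
qed

section \<open>At most three nondominating parts\<close>

text \<open>
  The third part is the complement of \<open>N[v]\<close>; it is nonempty because \<open>v\<close> is not universal.
\<close>

lemma neighborhood_split_extends:
  assumes v: "v \<in> verts G"
    and part: "partition_on (closed_neighborhood G v) {P, Q}"
    and nondom: "\<not> dominating_set G P" "\<not> dominating_set G Q"
  shows "nondominating_partition G {verts G - closed_neighborhood G v, P, Q}"
proof -
  let ?N = "closed_neighborhood G v"
  have sub: "?N \<subseteq> verts G"
    using v by (rule closed_neighborhood_subset_verts)
  have "?N \<noteq> verts G"
    using v no_universal_vertex by (auto simp: universal_vertex_def)
  then have "partition_on (verts G) (insert (verts G - ?N) {P, Q})"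
    using sub part by (subst partition_on_insert) (auto simp: double_diff partition_on_def disjnt_iff)
  moreover have "\<not> dominating_set G (verts G - ?N)"
    using v by (subst not_dominating_set_iff) auto
  ultimately show ?thesis
    using nondom by (auto simp: nondominating_partition_def)
qed

text \<open>
  If a single part contains all of \<open>N[v]\<close>, then \<open>P\<close> and \<open>Q\<close> below both are \<open>N[v]\<close>.
\<close>

lemma nondominating_split_of_neighborhood:
  assumes \<A>: "nondominating_partition G \<A>" and card: "card \<A> \<le> 3"
  obtains v P Q where "v \<in> verts G" "partition_on (closed_neighborhood G v) {P, Q}"
    "\<not> dominating_set G P" "\<not> dominating_set G Q"
proof -
  have part: "partition_on (verts G) \<A>"
    and nondom: "\<And>X. X \<in> \<A> \<Longrightarrow> \<not> dominating_set G X"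
    using \<A> by (auto simp: nondominating_partition_def)
  have fin: "finite \<A>"
    using \<A> by (rule finite_nondominating_partition)
  obtain X where X: "X \<in> \<A>"
    using part verts_nonempty by (auto simp: partition_on_def)
  have sub: "Y \<subseteq> verts G" if "Y \<in> \<A>" for Y
    using part that by (auto simp: partition_on_def)
  obtain v where v: "v \<in> verts G" and miss: "closed_neighborhood G v \<inter> X = {}"
    using nondom[OF X] not_dominating_set_iff[OF sub[OF X]] by blast
  let ?N = "closed_neighborhood G v"
  (* the traces of the parts on N[v]; the trace of X is empty, so at most two remain *)
  define \<P> where "\<P> = (\<inter>) ?N ` \<A> - {{}}"
  have \<P>: "partition_on ?N \<P>"
    using partition_on_restrict[OF part, of ?N] closed_neighborhood_subset_verts[OF v]
    by (simp add: \<P>_def Int_absorb2)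
  have "\<P> \<subseteq> (\<inter>) ?N ` (\<A> - {X})"
    using miss by (auto simp: \<P>_def)
  then have "card \<P> \<le> card (\<A> - {X})"
    using fin by (meson card_image_le card_mono finite_Diff finite_imageI le_trans)
  also have "\<dots> \<le> 2"
    using card X fin by simp
  finally have "card \<P> \<le> 2" .
  moreover have "\<P> \<noteq> {}"
    using \<P> by (auto simp: partition_on_def closed_neighborhood_def)
  moreover have "finite \<P>"
    using fin by (simp add: \<P>_def)
  ultimately obtain P Q where PQ: "\<P> = {P, Q}"
    by (meson nonempty_card_le_2E)
  have "\<not> dominating_set G R" if R: "R \<in> \<P>" for R
  proof -
    obtain Y where "Y \<in> \<A>" "R \<subseteq> Y"
      using R unfolding \<P>_def by blast
    then show ?thesis
      using nondom sub dominating_set_mono by metis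
  qed
  then show thesis
    using that[OF v] \<P> PQ by simp
qed

end

theorem theorem5:
  fixes G :: "('a, 'b) pre_digraph"
  assumes "graph G"
    and "verts G \<noteq> {}"
    and "\<not> (\<exists>v. universal_vertex G v)"
  shows "c_min G \<ge> 4 \<longleftrightarrow>
    (\<forall>v \<in> verts G. \<forall>P Q. partition_on (closed_neighborhood G v) {P, Q} \<longrightarrow>
       dominating_set G P \<or> dominating_set G Q)"
proof -
  interpret graph_without_universal_vertex G
    using assms
    by (simp add: graph_without_universal_vertex_def graph_without_universal_vertex_axioms_def)
  show ?thesis
  proof (intro iffI ballI allI impI)
    fix v P Q
    assume four: "c_min G \<ge> 4" and v: "v \<in> verts G"
      and part: "partition_on (closed_neighborhood G v) {P, Q}"
    show "dominating_set G P \<or> dominating_set G Q"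
    proof (rule ccontr)
      assume "\<not> (dominating_set G P \<or> dominating_set G Q)"
      then have "c_min G \<le> card {verts G - closed_neighborhood G v, P, Q}"
        using neighborhood_split_extends[OF v part] by (intro c_min_le_card) auto
      also have "\<dots> \<le> 3"
        by (simp add: card_insert_if)
      finally show False using four by simp
    qed
  next
    assume split: "\<forall>v \<in> verts G. \<forall>P Q. partition_on (closed_neighborhood G v) {P, Q} \<longrightarrow>
       dominating_set G P \<or> dominating_set G Q"
    obtain \<A> where \<A>: "nondominating_partition G \<A>" and card: "card \<A> = c_min G"
      by (rule c_min_attained)
    show "c_min G \<ge> 4"
    proof (rule ccontr)
      assume "\<not> c_min G \<ge> 4"
      then have "card \<A> \<le> 3" using card by simp
      with \<A> show False
        using split by (metis nondominating_split_of_neighborhood)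
    qed
  qed
qed

end
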